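(* Let $G_t$ be the group generated by the two linear transformations $s_1,s_2$ of $\mathbb{C}^6$ defined in the context, and let $H$ be the subgroup of $G_t$ generated by $s_2$. Then a complete set of representatives of the double cosets $H\backslash G_t/H$ (one for each double coset) is given by $\mathrm{id}$, $s_1$ and $s_1s_2s_1$.
   Context: Write vectors of $\mathbb{C}^6$ as ${}^t[b,a,c,d,e_1,e_2]$. The transformation $s_1$ sends $(b,a,c,d,e_1,e_2)$ to $(b,\ e_1-a,\ e_1-c,\ e_1+e_2-a-c,\ e_1,\ d+e_1-a-c)$, and $s_2$ exchanges $e_1$ and $e_2$ and fixes the other coordinates. (These are the parameter symmetries of the $A_n$ terminating balanced ${}_4F_3$ series of triangular type.) The group operation is composition. *)

theory Defs
  imports "HOL-Analysis.Analysis" "HOL-Algebra.Generated_Groups"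
begin

text \<open>The general linear group of \<open>\<complex>\<^sup>6\<close>, realised by complex-linear bijections under composition.\<close>

definition GL6 :: "(complex ^ 6 \<Rightarrow> complex ^ 6) monoid" where
  "GL6 = \<lparr>carrier = {f. Vector_Spaces.linear (*s) (*s) f \<and> bij f}, mult = (\<circ>), one = id\<rparr>"

text \<open>Coordinates \<open>1, \<dots>, 6\<close> of a vector are \<open>b, a, c, d, e\<^sub>1, e\<^sub>2\<close>, in this order
  (the index \<open>6\<close> is the same element as \<open>0\<close> of the index type).\<close>

definition s1 :: "complex ^ 6 \<Rightarrow> complex ^ 6" where
  "s1 v = (let b = v $ 1; a = v $ 2; c = v $ 3; d = v $ 4; e1 = v $ 5; e2 = v $ 6
           in vector [b, e1 - a, e1 - c, e1 + e2 - a - c, e1, d + e1 - a - c])"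

definition s2 :: "complex ^ 6 \<Rightarrow> complex ^ 6" where
  "s2 v = (let b = v $ 1; a = v $ 2; c = v $ 3; d = v $ 4; e1 = v $ 5; e2 = v $ 6
           in vector [b, a, c, d, e2, e1])"

definition G\<^sub>t :: "(complex ^ 6 \<Rightarrow> complex ^ 6) monoid" where
  "G\<^sub>t = GL6\<lparr>carrier := generate GL6 {s1, s2}\<rparr>"

definition H :: "(complex ^ 6 \<Rightarrow> complex ^ 6) set" where
  "H = generate G\<^sub>t {s2}"

definition double_cosets :: "('a, 'b) monoid_scheme \<Rightarrow> 'a set \<Rightarrow> 'a set \<Rightarrow> 'a set set" where
  "double_cosets G A B = {A #>\<^bsub>G\<^esub> g <#>\<^bsub>G\<^esub> B | g. g \<in> carrier G}"

text \<open>The list is required to be free of repetitions, so that its length is the number of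
  double cosets.\<close>

definition complete_double_coset_reps ::
    "('a, 'b) monoid_scheme \<Rightarrow> 'a set \<Rightarrow> 'a set \<Rightarrow> 'a list \<Rightarrow> bool" where
  "complete_double_coset_reps G A B rs \<longleftrightarrow>
     distinct rs \<and> set rs \<subseteq> carrier G \<and> (\<forall>D \<in> double_cosets G A B. \<exists>!r. r \<in> set rs \<and> r \<in> D)"

text \<open>Well-definedness: \<open>s\<^sub>1\<close> and \<open>s\<^sub>2\<close> are elements of the group \<^const>\<open>GL6\<close>, so that the
  generated subgroups are as intended.\<close>

lemma exhaust_6: "x = 1 \<or> x = 2 \<or> x = 3 \<or> x = 4 \<or> x = 5 \<or> x = 6" for x :: 6
proof (induct x)
  case (of_int z)
  then have "z = 0 \<or> z = 1 \<or> z = 2 \<or> z = 3 \<or> z = 4 \<or> z = 5" by (simp, arith)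
  then show ?case by auto
qed

lemma forall_6: "(\<forall>i::6. P i) \<longleftrightarrow> P 1 \<and> P 2 \<and> P 3 \<and> P 4 \<and> P 5 \<and> P 6"
  by (metis exhaust_6)

lemma vector_6:
  "(vector [x1, x2, x3, x4, x5, x6] :: 'a::zero ^ 6) $ 1 = x1"
  "(vector [x1, x2, x3, x4, x5, x6] :: 'a ^ 6) $ 2 = x2"
  "(vector [x1, x2, x3, x4, x5, x6] :: 'a ^ 6) $ 3 = x3"
  "(vector [x1, x2, x3, x4, x5, x6] :: 'a ^ 6) $ 4 = x4"
  "(vector [x1, x2, x3, x4, x5, x6] :: 'a ^ 6) $ 5 = x5"
  "(vector [x1, x2, x3, x4, x5, x6] :: 'a ^ 6) $ 6 = x6"
  unfolding vector_def by simp_all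

lemma group_GL6: "group GL6"
proof (rule groupI)
  fix f assume f: "f \<in> carrier GL6"
  then have lin: "Vector_Spaces.linear (*s) (*s) f" and bij: "bij f" by (simp_all add: GL6_def)
  obtain g where g: "Vector_Spaces.linear (*s) (*s) g" "g \<circ> f = id"
    using vec.linear_injective_left_inverse[OF lin bij_is_inj[OF bij]] by blast
  have "f (g y) = y" for y
  proof -
    obtain x where "y = f x" using bij_is_surj[OF bij] by (rule surjE)
    then show ?thesis using fun_cong[OF g(2), of x] by simp
  qed
  then have "f \<circ> g = id" by (simp add: fun_eq_iff)
  then have "bij g" using g(2) o_bij by blast
  then show "\<exists>g \<in> carrier GL6. g \<otimes>\<^bsub>GL6\<^esub> f = \<one>\<^bsub>GL6\<^esub>"
    using g by (intro bexI[of _ g]) (simp_all add: GL6_def)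
qed (auto simp: GL6_def bij_comp comp_assoc Vector_Spaces.linear_iff vec.vector_space_axioms)

lemma s1_s1: "s1 (s1 v) = v" and s2_s2: "s2 (s2 v) = v"
  by (simp_all add: s1_def s2_def Let_def vec_eq_iff forall_6 vector_6 algebra_simps)

lemma s1_in_GL6: "s1 \<in> carrier GL6"
proof -
  have "bij s1" by (rule o_bij[of s1]) (auto simp: s1_s1)
  then show ?thesis
    by (simp add: GL6_def Vector_Spaces.linear_iff vec.vector_space_axioms s1_def Let_def
        vec_eq_iff forall_6 vector_6 algebra_simps)
qed

lemma s2_in_GL6: "s2 \<in> carrier GL6"
proof -
  have "bij s2" by (rule o_bij[of s2]) (auto simp: s2_s2)
  then show ?thesis
    by (simp add: GL6_def Vector_Spaces.linear_iff vec.vector_space_axioms s2_def Let_def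
        vec_eq_iff forall_6 vector_6 algebra_simps)
qed

end

theory Submission
  imports Defs
begin

text \<open>The group \<open>G\<^sub>t\<close> is dihedral of order 8: besides \<open>s\<^sub>1\<^sup>2 = s\<^sub>2\<^sup>2 = id\<close> there is the braid relation
  \<open>s\<^sub>1s\<^sub>2s\<^sub>1s\<^sub>2 = s\<^sub>2s\<^sub>1s\<^sub>2s\<^sub>1\<close> (\<open>braid_relation\<close>). Since \<open>H = {id, s\<^sub>2}\<close>, the relation rewrites every
  word in the generators as \<open>h r h'\<close> with \<open>h, h' \<in> H\<close> and \<open>r\<close> one of the three representatives
  (\<open>G\<^sub>t_cover\<close>), so each double coset contains at least one of them.

  That no double coset contains two is seen from a matrix coefficient. The basis vector
  \<open>v\<close> along \<open>d\<close> is fixed by \<open>s\<^sub>2\<close>, and the functional \<open>a + d\<close> is invariant under \<open>s\<^sub>2\<close>, so the number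
  \<open>(a + d)(g v)\<close> depends only on \<open>H g H\<close>. It equals 1, 0, 2 at \<open>id\<close>, \<open>s\<^sub>1\<close>, \<open>s\<^sub>1s\<^sub>2s\<^sub>1\<close>.\<close>

text \<open>As involutions are their own inverses, every element of the generated subgroup is
  a positive word in the generators, so a set containing the identity captures the subgroup
  once it is stable under left multiplication by single generators.\<close>

lemma (in group) generate_involutions_subset:
  assumes S: "S \<subseteq> carrier G" and inv: "\<And>s. s \<in> S \<Longrightarrow> s \<otimes> s = \<one>"
    and U: "U \<subseteq> carrier G" "\<one> \<in> U"
    and step: "\<And>s u. s \<in> S \<Longrightarrow> u \<in> U \<Longrightarrow> s \<otimes> u \<in> U"
  shows "generate G S \<subseteq> U"
proof
  fix g assume g: "g \<in> generate G S"
  then have "\<forall>u \<in> U. g \<otimes> u \<in> U"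
  proof induction
    case one
    then show ?case using U by auto
  next
    case (incl s)
    then show ?case using step by blast
  next
    case (inv s)
    moreover have "inv s = s"
      using inv S assms(2) by (auto intro: inv_equality)
    ultimately show ?case using step by simp
  next
    case (eng g h)
    then have "g \<in> carrier G" "h \<in> carrier G"
      using S generate_in_carrier by blast+
    then show ?case
      using eng.IH U by (auto simp: m_assoc subset_iff)
  qed
  moreover have "g \<in> carrier G"
    using g S generate_in_carrier by blast
  ultimately show "g \<in> U"
    using U by force
qed

lemma (in group) generate_involution:
  assumes y: "y \<in> carrier G" "y \<otimes> y = \<one>"
  shows "generate G {y} = {\<one>, y}"
proof
  show "generate G {y} \<subseteq> {\<one>, y}"
    using y by (intro generate_involutions_subset) auto
  show "{\<one>, y} \<subseteq> generate G {y}"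
    by (auto intro: generate.intros)
qed

lemma GL6_simps [simp]: "mult GL6 = (\<circ>)" "one GL6 = id"
  by (simp_all add: GL6_def)

lemma G\<^sub>t_simps [simp]: "carrier G\<^sub>t = generate GL6 {s1, s2}" "mult G\<^sub>t = (\<circ>)" "one G\<^sub>t = id"
  by (simp_all add: G\<^sub>t_def)

lemma group_G\<^sub>t: "group G\<^sub>t"
  unfolding G\<^sub>t_def using group_GL6 s1_in_GL6 s2_in_GL6
  by (intro subgroup.subgroup_is_group group.generate_is_subgroup) auto

lemma involutions [simp]: "s1 \<circ> s1 = id" "s2 \<circ> s2 = id"
  by (simp_all add: fun_eq_iff s1_s1 s2_s2)

lemma H_eq: "H = {id, s2}"
  using group.generate_involution[OF group_G\<^sub>t, of s2]
  by (simp add: H_def generate.incl)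

lemma double_coset_eq:
  "H #>\<^bsub>G\<^sub>t\<^esub> g <#>\<^bsub>G\<^sub>t\<^esub> H = {h \<circ> g \<circ> h' | h h'. h \<in> H \<and> h' \<in> H}"
  unfolding r_coset_def set_mult_def G\<^sub>t_simps by blast

lemma braid_relation: "s1 (s2 (s1 (s2 v))) = s2 (s1 (s2 (s1 v)))"
  by (simp add: s1_def s2_def Let_def vec_eq_iff forall_6 vector_6 algebra_simps)

text \<open>Multiplying \<open>h r h'\<close> by \<open>s\<^sub>1\<close> on the left leads out of the given form only when
  \<open>h = s\<^sub>2\<close> and \<open>r \<noteq> id\<close>; the braid relation then moves the alternating word back, for instance
  \<open>s\<^sub>1 (s\<^sub>2 s\<^sub>1 s\<^sub>2) = s\<^sub>2 (s\<^sub>1 s\<^sub>2 s\<^sub>1)\<close> and \<open>s\<^sub>1 (s\<^sub>2 s\<^sub>1 s\<^sub>2 s\<^sub>1) = s\<^sub>2 s\<^sub>1 s\<^sub>2\<close>.\<close>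

lemma G\<^sub>t_cover:
  assumes "g \<in> carrier G\<^sub>t"
  obtains h r h' where "h \<in> H" "r \<in> {id, s1, s1 \<circ> s2 \<circ> s1}" "h' \<in> H"
    "g = h \<circ> r \<circ> h'"
proof -
  interpret group GL6 by (rule group_GL6)
  define U where "U = {id, s2, s1, s2 \<circ> s1, s1 \<circ> s2, s2 \<circ> s1 \<circ> s2,
    s1 \<circ> s2 \<circ> s1, s2 \<circ> (s1 \<circ> s2 \<circ> s1)}"
  have braid: "s1 \<circ> (s2 \<circ> (s1 \<circ> s2)) = s2 \<circ> (s1 \<circ> (s2 \<circ> s1))"
    by (simp add: fun_eq_iff braid_relation)
  have "generate GL6 {s1, s2} \<subseteq> U"
  proof (rule generate_involutions_subset)
    show "U \<subseteq> carrier GL6"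
      using m_closed[unfolded GL6_simps] one_closed[unfolded GL6_simps] s1_in_GL6 s2_in_GL6
      by (auto simp: U_def)
    show "s \<otimes>\<^bsub>GL6\<^esub> u \<in> U" if "s \<in> {s1, s2}" "u \<in> U" for s u
    proof -
      have "s1 \<circ> (s2 \<circ> (s1 \<circ> (s2 \<circ> s1))) = s2 \<circ> (s1 \<circ> s2)"
        by (simp add: fun_eq_iff braid_relation[symmetric] s1_s1 s2_s2)
      moreover have "s1 \<circ> (s1 \<circ> w) = w" "s2 \<circ> (s2 \<circ> w) = w" for w :: "complex ^ 6 \<Rightarrow> complex ^ 6"
        by (simp_all add: fun_eq_iff s1_s1 s2_s2)
      ultimately show ?thesis
        using that braid by (auto simp: U_def comp_assoc)
    qed
  qed (use s1_in_GL6 s2_in_GL6 in \<open>auto simp: U_def\<close>)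
  then have "g \<in> U" using assms by auto
  then show thesis
    unfolding U_def using that[of id _ id] that[of s2 id id] that[of s2 _ id] that[of id _ s2]
      that[of s2 _ s2]
    by (auto simp: H_eq)
qed

definition coset_invariant :: "(complex ^ 6 \<Rightarrow> complex ^ 6) \<Rightarrow> complex" where
  "coset_invariant g = (let w = g (vector [0, 0, 0, 1, 0, 0]) in w $ 2 + w $ 4)"

lemma coset_invariant_H:
  assumes "h \<in> H" "h' \<in> H"
  shows "coset_invariant (h \<circ> g \<circ> h') = coset_invariant g"
proof -
  have "s2 (vector [0, 0, 0, 1, 0, 0]) = vector [0, 0, 0, 1, 0, 0]"
    by (simp add: s2_def vector_6)
  moreover have "s2 w $ 2 = w $ 2" "s2 w $ 4 = w $ 4" for w
    by (simp_all add: s2_def Let_def vector_6)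
  ultimately show ?thesis
    using assms by (auto simp: coset_invariant_def H_eq Let_def)
qed

lemma coset_invariant_reps:
  "coset_invariant id = 1" "coset_invariant s1 = 0" "coset_invariant (s1 \<circ> s2 \<circ> s1) = 2"
  by (simp_all add: coset_invariant_def s1_def s2_def Let_def vector_6)

theorem mainTheorem5:
  shows "complete_double_coset_reps G\<^sub>t H H [id, s1, s1 \<circ> s2 \<circ> s1]"
  unfolding complete_double_coset_reps_def
proof (intro conjI ballI)
  let ?R = "{id, s1, s1 \<circ> s2 \<circ> s1}"
  have inj: "inj_on coset_invariant ?R"
    by (auto simp: inj_on_def coset_invariant_reps)
  show "distinct [id, s1, s1 \<circ> s2 \<circ> s1]"
    using coset_invariant_reps by auto
  have "s1 \<in> carrier G\<^sub>t" "s2 \<in> carrier G\<^sub>t"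
    by (simp_all add: generate.incl)
  then show "set [id, s1, s1 \<circ> s2 \<circ> s1] \<subseteq> carrier G\<^sub>t"
    using group.is_monoid[OF group_G\<^sub>t, THEN monoid.m_closed]
      group.is_monoid[OF group_G\<^sub>t, THEN monoid.one_closed] by simp
  fix D assume "D \<in> double_cosets G\<^sub>t H H"
  then obtain g where g: "g \<in> carrier G\<^sub>t"
    and D: "D = {h \<circ> g \<circ> h' | h h'. h \<in> H \<and> h' \<in> H}"
    unfolding double_cosets_def double_coset_eq by blast
  obtain h r h' where r: "h \<in> H" "r \<in> ?R" "h' \<in> H" "g = h \<circ> r \<circ> h'"
    using G\<^sub>t_cover[OF g] by blast
  have "h \<circ> h = id" "h' \<circ> h' = id" using r by (auto simp: H_eq)
  then have "r = h \<circ> g \<circ> h'"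
    unfolding r(4) by (metis comp_assoc comp_id id_comp)
  then have "r \<in> D" using r D by blast
  moreover have "r' = r''" if "r' \<in> ?R" "r' \<in> D" "r'' \<in> ?R" "r'' \<in> D" for r' r''
  proof -
    have "coset_invariant x = coset_invariant g" if "x \<in> D" for x
      using that D coset_invariant_H by blast
    then show ?thesis using that by (intro inj_onD[OF inj]) simp_all
  qed
  ultimately show "\<exists>!r. r \<in> set [id, s1, s1 \<circ> s2 \<circ> s1] \<and> r \<in> D"
    using r(2) unfolding list.set by blast
qed

end
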